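(* Let $(N,Q,C_1,C_2,\dots)$ be a nonnegative random vector with $N\in\mathbb N_+\cup\{\infty\}$ and $P(Q>0)>0$, and suppose that for some $\alpha>0$: (a) $E\left[\sum_{i=1}^N C_i^\alpha\right]=1$ and $E\left[\sum_{i=1}^N C_i^\alpha\log C_i\right]\in(0,\infty)$; (b) $E\left[\sum_{i=1}^N C_i^\beta\right]<1$ for some $0<\beta<\alpha$, and $E[Q^\alpha]<\infty$; (c) $P\left(\sum_{i=1}^N C_i^\alpha=0\right)=0$. Let $W=\bigvee_{\boldsymbol i\in\mathcal T}(S_{\boldsymbol i}+Y_{\boldsymbol i})$. Then for all $t$, $$e^{\alpha t}P(W>t)=\widetilde E\left[1(\boldsymbol J_{\tau(t)}=\gamma(t))\,e^{-\alpha(V_{\tau(t)}-t)}\,D_{\boldsymbol J_{\tau(t)}}^{-1}\right].$$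
   Context: Conventions: $\log 0=-\infty$, $0\cdot\log 0=0$, $x\vee y=\max\{x,y\}$, $\inf\varnothing=\infty$ for integer-valued infima. Weighted branching tree. Let $U=\bigcup_{k\ge0}\mathbb N_+^k$ be the set of finite sequences of positive integers ($\mathbb N_+^0=\{\emptyset\}$); $|\boldsymbol i|$ is the length of $\boldsymbol i$ and $(\boldsymbol i,j)$ is concatenation. $U$ is ordered length-lexicographically: $\boldsymbol i\prec\boldsymbol j$ if $|\boldsymbol i|<|\boldsymbol j|$, or $|\boldsymbol i|=|\boldsymbol j|$ and at the first coordinate $t$ where they differ $i_t<j_t$. Let $\boldsymbol\psi_{\boldsymbol i}=(N_{\boldsymbol i},Q_{\boldsymbol i},C_{(\boldsymbol i,1)},C_{(\boldsymbol i,2)},\dots)$, $\boldsymbol i\in U$, be i.i.d. copies of $\boldsymbol\psi=(N,Q,C_1,C_2,\dots)$. Let $A_0=\{\emptyset\}$, $A_n=\{(\boldsymbol i,j):\boldsymbol i\in A_{n-1},\,j\in\mathbb N_+,\,1\le j\le N_{\boldsymbol i}\}$, $\mathcal T=\bigcup_{n\ge0}A_n$. Let $\Pi_\emptyset=1$, $\Pi_{(\boldsymbol i,j)}=C_{(\boldsymbol i,j)}\Pi_{\boldsymbol i}$, $S_{\boldsymbol i}=\log\Pi_{\boldsymbol i}$, $Y_{\boldsymbol i}=\log Q_{\boldsymbol i}$. Spine. Let $D_{\boldsymbol i}=\sum_{r=1}^{N_{\boldsymbol i}}C_{(\boldsymbol i,r)}^\alpha$. Set $\boldsymbol J_0=\emptyset$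 and, conditionally on all the $\{\boldsymbol\psi_{\boldsymbol i}\}$ and on $\boldsymbol J_0,\dots,\boldsymbol J_{k-1}$, let $\boldsymbol J_k=(\boldsymbol J_{k-1},i)$ with probability $C_{(\boldsymbol J_{k-1},i)}^\alpha/D_{\boldsymbol J_{k-1}}$, $1\le i\le N_{\boldsymbol J_{k-1}}$, $k\ge1$. Let $V_k=S_{\boldsymbol J_k}$ (so $V_0=0$) and $\xi_k=Y_{\boldsymbol J_k}$. Change of measure. Let $\mathcal F_k=\sigma(\boldsymbol\psi_{\boldsymbol i}:\boldsymbol i\in A_s,\,s<k)$, $\mathcal G_k=\sigma(\mathcal F_k\cup\sigma(\boldsymbol J_s:s\le k))$ for $k\ge1$, $\mathcal F_0=\mathcal G_0$ trivial, and $L_0=1$, $L_k=\prod_{r=0}^{k-1}D_{\boldsymbol J_r}$, a mean-one nonnegative $(\mathcal G_k)$-martingale under $P$. $\widetilde P$ is the probability measure on $\sigma(\bigcup_k\mathcal G_k)$ with $\widetilde P(A)=E[1(A)L_k]$ for $A\in\mathcal G_k$, $k\ge0$; $\widetilde E$ is its expectation. Hitting times. $\gamma(t)=\inf\{\boldsymbol i\in\mathcal T:S_{\boldsymbol i}+Y_{\boldsymbol i}>t\}$, the infimum (in fact minimum, when the set is nonempty) being with respect to $\prec$; $\tau(t)=\inf\{k\ge0:V_k+\xi_k>t\}$. (Under the hypotheses $\tau(t)<\infty$ $\widetilde P$-a.s., hence also $\gamma(t)$ is well defined $\widetilde P$-a.s.) *)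

theory Defs
  imports "HOL-Probability.Probability"
begin

text \<open>Logarithm with the convention \<open>log 0 = - \<infinity>\<close>; only used for nonnegative arguments.\<close>

definition elog :: "real \<Rightarrow> ereal" where
  "elog x = (if x = 0 then - \<infinity> else ereal (ln x))"

text \<open>Sums \<open>f 1 + f 2 + \<dots> + f n\<close> for \<open>n \<in> {0, 1, 2, \<dots>, \<infinity>}\<close>, as series over \<open>j = 0, 1, \<dots>\<close>
  with \<open>r = j + 1\<close>.\<close>

definition branch_term :: "enat \<Rightarrow> (nat \<Rightarrow> 'b::zero) \<Rightarrow> nat \<Rightarrow> 'b" where
  "branch_term n f j = (if enat (Suc j) \<le> n then f (Suc j) else 0)"

definition branch_sum :: "enat \<Rightarrow> (nat \<Rightarrow> 'b::{comm_monoid_add, topological_space}) \<Rightarrow> 'b" where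
  "branch_sum n f = (\<Sum>j. branch_term n f j)"


section \<open>Branching vectors and the weighted branching tree\<close>

type_synonym bvec = "enat \<times> real \<times> (nat \<Rightarrow> real)"

definition bvec_space :: "bvec measure" where
  "bvec_space = count_space UNIV \<Otimes>\<^sub>M borel \<Otimes>\<^sub>M Pi\<^sub>M {1..} (\<lambda>_. borel)"

text \<open>The vector \<open>(n, q, c 1, c 2, \<dots>)\<close>; points of \<^const>\<open>PiM\<close> are undefined off the index set,
  hence the restriction.\<close>

definition bvec :: "enat \<Rightarrow> real \<Rightarrow> (nat \<Rightarrow> real) \<Rightarrow> bvec" where
  "bvec n q c = (n, q, restrict c {1..})"

definition labels :: "nat list set" where
  "labels = {i. \<forall>x\<in>set i. 1 \<le> x}"

text \<open>On lists, \<open>lenlex less_than\<close> compares lengths first and then, for equal lengths, the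
  first entries that differ.\<close>

definition label_less :: "nat list \<Rightarrow> nat list \<Rightarrow> bool" where
  "label_less i j \<longleftrightarrow> (i, j) \<in> lenlex less_than"

definition psi ::
  "(nat list \<Rightarrow> 'a \<Rightarrow> enat) \<Rightarrow> (nat list \<Rightarrow> 'a \<Rightarrow> real) \<Rightarrow> (nat list \<Rightarrow> 'a \<Rightarrow> real) \<Rightarrow>
   nat list \<Rightarrow> 'a \<Rightarrow> bvec" where
  "psi N Q C i \<omega> = bvec (N i \<omega>) (Q i \<omega>) (\<lambda>j. C (i @ [j]) \<omega>)"

primrec generation :: "(nat list \<Rightarrow> 'a \<Rightarrow> enat) \<Rightarrow> nat \<Rightarrow> 'a \<Rightarrow> nat list set" where
  "generation N 0 \<omega> = {[]}"
| "generation N (Suc n) \<omega> =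
     {i @ [j] | i j. i \<in> generation N n \<omega> \<and> 1 \<le> j \<and> enat j \<le> N i \<omega>}"

definition tree :: "(nat list \<Rightarrow> 'a \<Rightarrow> enat) \<Rightarrow> 'a \<Rightarrow> nat list set" where
  "tree N \<omega> = (\<Union>n. generation N n \<omega>)"

text \<open>The product of the weights along the path from the root to \<open>i\<close>; the recursion in terms of
  \<open>(i, j)\<close> follows below. The weight \<open>C []\<close> is never used.\<close>

definition weight :: "(nat list \<Rightarrow> 'a \<Rightarrow> real) \<Rightarrow> nat list \<Rightarrow> 'a \<Rightarrow> real" where
  "weight C i \<omega> = (\<Prod>k\<in>{1..length i}. C (take k i) \<omega>)"

lemma weight_Nil: "weight C [] \<omega> = 1"
  by (simp add: weight_def)

lemma weight_snoc: "weight C (i @ [j]) \<omega> = C (i @ [j]) \<omega> * weight C i \<omega>"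
  by (simp add: weight_def mult.commute)

definition S :: "(nat list \<Rightarrow> 'a \<Rightarrow> real) \<Rightarrow> nat list \<Rightarrow> 'a \<Rightarrow> ereal" where
  "S C i \<omega> = elog (weight C i \<omega>)"

definition Y :: "(nat list \<Rightarrow> 'a \<Rightarrow> real) \<Rightarrow> nat list \<Rightarrow> 'a \<Rightarrow> ereal" where
  "Y Q i \<omega> = elog (Q i \<omega>)"

definition W ::
  "(nat list \<Rightarrow> 'a \<Rightarrow> enat) \<Rightarrow> (nat list \<Rightarrow> 'a \<Rightarrow> real) \<Rightarrow> (nat list \<Rightarrow> 'a \<Rightarrow> real) \<Rightarrow>
   'a \<Rightarrow> ereal" where
  "W N Q C \<omega> = (SUP i\<in>tree N \<omega>. S C i \<omega> + Y Q i \<omega>)"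

definition D ::
  "real \<Rightarrow> (nat list \<Rightarrow> 'a \<Rightarrow> enat) \<Rightarrow> (nat list \<Rightarrow> 'a \<Rightarrow> real) \<Rightarrow> nat list \<Rightarrow> 'a \<Rightarrow> ennreal" where
  "D \<alpha> N C i \<omega> = branch_sum (N i \<omega>) (\<lambda>r. ennreal (C (i @ [r]) \<omega> powr \<alpha>))"


section \<open>The spine\<close>

text \<open>The information in all vectors \<open>\<psi>\<^sub>i\<close> and in \<open>J\<^sub>0, \<dots>, J\<^sub>k\<close>.\<close>

definition spine_past ::
  "'a measure \<Rightarrow> (nat list \<Rightarrow> 'a \<Rightarrow> enat) \<Rightarrow> (nat list \<Rightarrow> 'a \<Rightarrow> real) \<Rightarrow> (nat list \<Rightarrow> 'a \<Rightarrow> real) \<Rightarrow>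
   (nat \<Rightarrow> 'a \<Rightarrow> nat list) \<Rightarrow> nat \<Rightarrow> 'a measure" where
  "spine_past M N Q C J k = sigma (space M)
     ({psi N Q C i -` B \<inter> space M | i B. i \<in> labels \<and> B \<in> sets bvec_space} \<union>
      {J s -` {i} \<inter> space M | s i. s \<le> k})"

definition is_spine ::
  "'a measure \<Rightarrow> real \<Rightarrow> (nat list \<Rightarrow> 'a \<Rightarrow> enat) \<Rightarrow> (nat list \<Rightarrow> 'a \<Rightarrow> real) \<Rightarrow>
   (nat list \<Rightarrow> 'a \<Rightarrow> real) \<Rightarrow> (nat \<Rightarrow> 'a \<Rightarrow> nat list) \<Rightarrow> bool" where
  "is_spine M \<alpha> N Q C J \<longleftrightarrow>
     (\<forall>k. J k \<in> M \<rightarrow>\<^sub>M count_space UNIV) \<and>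
     (\<forall>\<omega>\<in>space M. J 0 \<omega> = []) \<and>
     (\<forall>k. \<forall>i\<ge>1. AE \<omega> in M.
        nn_cond_exp M (spine_past M N Q C J k)
          (indicator {\<omega>' \<in> space M. J (Suc k) \<omega>' = J k \<omega>' @ [i]}) \<omega> =
        (if enat i \<le> N (J k \<omega>) \<omega>
         then ennreal (C (J k \<omega> @ [i]) \<omega> powr \<alpha>) / D \<alpha> N C (J k \<omega>) \<omega> else 0))"

definition V :: "(nat list \<Rightarrow> 'a \<Rightarrow> real) \<Rightarrow> (nat \<Rightarrow> 'a \<Rightarrow> nat list) \<Rightarrow> nat \<Rightarrow> 'a \<Rightarrow> ereal" where
  "V C J k \<omega> = S C (J k \<omega>) \<omega>"

definition xi :: "(nat list \<Rightarrow> 'a \<Rightarrow> real) \<Rightarrow> (nat \<Rightarrow> 'a \<Rightarrow> nat list) \<Rightarrow> nat \<Rightarrow> 'a \<Rightarrow> ereal" where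
  "xi Q J k \<omega> = Y Q (J k \<omega>) \<omega>"


section \<open>The change of measure\<close>

text \<open>Because the index set \<open>A\<^sub>s\<close> is random, \<open>\<sigma>(\<psi>\<^sub>i : i \<in> A\<^sub>s, s < k)\<close> is generated by the events
  \<open>{i \<in> A\<^sub>s, \<psi>\<^sub>i \<in> B}\<close> with \<open>s < k\<close>.\<close>

definition F_alg ::
  "'a measure \<Rightarrow> (nat list \<Rightarrow> 'a \<Rightarrow> enat) \<Rightarrow> (nat list \<Rightarrow> 'a \<Rightarrow> real) \<Rightarrow> (nat list \<Rightarrow> 'a \<Rightarrow> real) \<Rightarrow>
   nat \<Rightarrow> 'a measure" where
  "F_alg M N Q C k = sigma (space M)
     {{\<omega> \<in> space M. i \<in> generation N s \<omega> \<and> psi N Q C i \<omega> \<in> B} | i s B.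
        s < k \<and> i \<in> labels \<and> B \<in> sets bvec_space}"

definition G_alg ::
  "'a measure \<Rightarrow> (nat list \<Rightarrow> 'a \<Rightarrow> enat) \<Rightarrow> (nat list \<Rightarrow> 'a \<Rightarrow> real) \<Rightarrow> (nat list \<Rightarrow> 'a \<Rightarrow> real) \<Rightarrow>
   (nat \<Rightarrow> 'a \<Rightarrow> nat list) \<Rightarrow> nat \<Rightarrow> 'a measure" where
  "G_alg M N Q C J k = sigma (space M)
     (sets (F_alg M N Q C k) \<union> {J s -` {i} \<inter> space M | s i. s \<le> k})"

definition L ::
  "real \<Rightarrow> (nat list \<Rightarrow> 'a \<Rightarrow> enat) \<Rightarrow> (nat list \<Rightarrow> 'a \<Rightarrow> real) \<Rightarrow> (nat \<Rightarrow> 'a \<Rightarrow> nat list) \<Rightarrow>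
   nat \<Rightarrow> 'a \<Rightarrow> ennreal" where
  "L \<alpha> N C J k \<omega> = (\<Prod>r<k. D \<alpha> N C (J r \<omega>) \<omega>)"

definition is_tilted_measure ::
  "'a measure \<Rightarrow> real \<Rightarrow> (nat list \<Rightarrow> 'a \<Rightarrow> enat) \<Rightarrow> (nat list \<Rightarrow> 'a \<Rightarrow> real) \<Rightarrow>
   (nat list \<Rightarrow> 'a \<Rightarrow> real) \<Rightarrow> (nat \<Rightarrow> 'a \<Rightarrow> nat list) \<Rightarrow> 'a measure \<Rightarrow> bool" where
  "is_tilted_measure M \<alpha> N Q C J Pt \<longleftrightarrow>
     prob_space Pt \<and>
     space Pt = space M \<and>
     sets Pt = sigma_sets (space M) (\<Union>k. sets (G_alg M N Q C J k)) \<and>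
     (\<forall>k. \<forall>A\<in>sets (G_alg M N Q C J k).
        emeasure Pt A = (\<integral>\<^sup>+\<omega>. indicator A \<omega> * L \<alpha> N C J k \<omega> \<partial>M))"


section \<open>Hitting times\<close>

definition tau ::
  "(nat list \<Rightarrow> 'a \<Rightarrow> real) \<Rightarrow> (nat list \<Rightarrow> 'a \<Rightarrow> real) \<Rightarrow> (nat \<Rightarrow> 'a \<Rightarrow> nat list) \<Rightarrow>
   real \<Rightarrow> 'a \<Rightarrow> enat" where
  "tau Q C J t \<omega> = Inf {enat k | k. V C J k \<omega> + xi Q J k \<omega> > ereal t}"

definition exceedances ::
  "(nat list \<Rightarrow> 'a \<Rightarrow> enat) \<Rightarrow> (nat list \<Rightarrow> 'a \<Rightarrow> real) \<Rightarrow> (nat list \<Rightarrow> 'a \<Rightarrow> real) \<Rightarrow>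
   real \<Rightarrow> 'a \<Rightarrow> nat list set" where
  "exceedances N Q C t \<omega> = {i \<in> tree N \<omega>. S C i \<omega> + Y Q i \<omega> > ereal t}"

text \<open>The minimum of the set of exceedances; it exists when the set is nonempty since
  \<^const>\<open>label_less\<close> is a well-order. The value \<^const>\<open>None\<close> stands for an undefined \<open>\<gamma>(t)\<close>.\<close>

definition gamma ::
  "(nat list \<Rightarrow> 'a \<Rightarrow> enat) \<Rightarrow> (nat list \<Rightarrow> 'a \<Rightarrow> real) \<Rightarrow> (nat list \<Rightarrow> 'a \<Rightarrow> real) \<Rightarrow>
   real \<Rightarrow> 'a \<Rightarrow> nat list option" where
  "gamma N Q C t \<omega> =
     (if exceedances N Q C t \<omega> = {} then None
      else Some (THE i. i \<in> exceedances N Q C t \<omega> \<and>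
                   (\<forall>j\<in>exceedances N Q C t \<omega>. j = i \<or> label_less i j)))"

text \<open>The random variable \<open>1(J\<^sub>\<tau> = \<gamma>(t)) exp (- \<alpha> (V\<^sub>\<tau> - t)) / D\<^sub>J\<^sub>\<tau>\<close> with \<open>\<tau> = \<tau>(t)\<close>, set to \<open>0\<close> on
  the null event \<open>\<tau> = \<infinity>\<close>. Where \<open>\<tau> = k < \<infinity>\<close> one has \<open>V\<^sub>k > - \<infinity>\<close>, so that \<^const>\<open>real_of_ereal\<close> is
  harmless.\<close>

definition hitting_payoff ::
  "real \<Rightarrow> (nat list \<Rightarrow> 'a \<Rightarrow> enat) \<Rightarrow> (nat list \<Rightarrow> 'a \<Rightarrow> real) \<Rightarrow> (nat list \<Rightarrow> 'a \<Rightarrow> real) \<Rightarrow>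
   (nat \<Rightarrow> 'a \<Rightarrow> nat list) \<Rightarrow> real \<Rightarrow> 'a \<Rightarrow> ennreal" where
  "hitting_payoff \<alpha> N Q C J t \<omega> =
     (case tau Q C J t \<omega> of
        enat k \<Rightarrow>
          of_bool (gamma N Q C t \<omega> = Some (J k \<omega>)) *
          ennreal (exp (- \<alpha> * (real_of_ereal (V C J k \<omega>) - t))) *
          inverse (D \<alpha> N C (J k \<omega>) \<omega>)
      | \<infinity> \<Rightarrow> 0)"

end

theory Submission
  imports Defs
begin

text \<open>Why the identity holds. The event \<open>W > t\<close> means that some node of the tree exceeds \<open>t\<close>, so it
  is the disjoint union over labels \<open>i\<close> of the events \<open>\<gamma>(t) = i\<close>. On the other side, if the spine
  passes through \<open>\<gamma>(t) = i\<close>, then it does so at time \<open>|i|\<close>, and this time is \<open>\<tau>(t)\<close>: an earlier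
  exceedance on the spine would be a shorter label and hence would precede \<open>i\<close>. The payoff is
  therefore a sum over \<open>i\<close> of terms that live on \<open>J\<^bsub>|i|\<^esub> = i\<close> and \<open>\<gamma>(t) = i\<close> (\<open>hitting_payoff_eq\<close>).

  It remains to compare term by term (\<open>tilted_payoff_at\<close>). The event \<open>\<gamma>(t) = i\<close> is decided by the
  vectors of the tree nodes in generations up to \<open>|i|\<close>, so the \<open>i\<close>-th term is measurable with
  respect to \<open>G\<^bsub>|i|+1\<^esub>\<close>, on which \<open>Pt\<close> has density \<open>L\<^bsub>|i|+1\<^esub>\<close>, the product of \<open>D\<close> over the path from
  the root to \<open>i\<close> including \<open>i\<close> itself. The factor \<open>1 / D\<^sub>i\<close> of the payoff removes the last factor, and
  given all branching vectors the spine runs through \<open>i\<close> with the conditional probability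
  \<open>\<Pi>\<^sub>i\<^sup>\<alpha>\<close> divided by the product of \<open>D\<close> over the strict ancestors of \<open>i\<close> (\<open>spine_law\<close>). The products
  of \<open>D\<close> cancel, and \<open>\<Pi>\<^sub>i\<^sup>\<alpha> exp (- \<alpha> (S\<^sub>i - t)) = exp (\<alpha> t)\<close> leaves \<open>exp (\<alpha> t) P(\<gamma>(t) = i)\<close>.

  The cancellation takes place almost surely, because \<open>0 < D\<^sub>i < \<infinity>\<close> and the weights are nonnegative
  almost surely for all of the countably many labels.\<close>

section \<open>Deterministic facts about the tree and the first exceedance\<close>

lemma labels_snoc [simp]: "i @ [j] \<in> labels \<longleftrightarrow> i \<in> labels \<and> 1 \<le> j"
  by (auto simp: labels_def)

lemma labels_Nil [simp]: "[] \<in> labels"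
  by (simp add: labels_def)

lemma generation_length: "i \<in> generation N n \<omega> \<Longrightarrow> length i = n"
  by (induction n arbitrary: i) auto

lemma generation_labels: "i \<in> generation N n \<omega> \<Longrightarrow> i \<in> labels"
  by (induction n arbitrary: i) auto

lemma tree_labels: "i \<in> tree N \<omega> \<Longrightarrow> i \<in> labels"
  by (auto simp: tree_def intro: generation_labels)

lemma generation_iff_tree: "i \<in> generation N n \<omega> \<longleftrightarrow> i \<in> tree N \<omega> \<and> length i = n"
  by (auto simp: tree_def dest: generation_length)

lemma tree_Nil [simp]: "[] \<in> tree N \<omega>"
  using generation_iff_tree[of "[]" N 0 \<omega>] by simp

lemma tree_snoc [simp]:
  "i @ [j] \<in> tree N \<omega> \<longleftrightarrow> i \<in> tree N \<omega> \<and> 1 \<le> j \<and> enat j \<le> N i \<omega>"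
proof -
  have "i @ [j] \<in> tree N \<omega> \<longleftrightarrow> i @ [j] \<in> generation N (Suc (length i)) \<omega>"
    by (simp add: generation_iff_tree del: generation.simps)
  also have "\<dots> \<longleftrightarrow> i \<in> tree N \<omega> \<and> 1 \<le> j \<and> enat j \<le> N i \<omega>"
    by (auto simp: generation_iff_tree)
  finally show ?thesis .
qed

lemma label_less_asym: "label_less i j \<Longrightarrow> \<not> label_less j i"
  unfolding label_less_def by (metis wf_asym wf_lenlex wf_less_than)

lemma label_less_linear: "i = j \<or> label_less i j \<or> label_less j i"
proof -
  have "total (lenlex less_than)"
    by (rule total_lenlex) (auto simp: total_on_def)
  then show ?thesis unfolding label_less_def total_on_def by blast
qed

lemma label_less_length: "label_less i j \<Longrightarrow> length i \<le> length j"
  by (auto simp: label_less_def lenlex_conv)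

lemma label_less_shorter: "length i < length j \<Longrightarrow> label_less i j"
  by (auto simp: label_less_def lenlex_conv)

text \<open>The minimum exists because the length-lexicographic order is well-founded, and it is unique because
  the order is total; this replaces the definite description by a first-order condition.\<close>

lemma gamma_eq_Some_iff:
  "gamma N Q C t \<omega> = Some i \<longleftrightarrow>
     i \<in> exceedances N Q C t \<omega> \<and> (\<forall>j. label_less j i \<longrightarrow> j \<notin> exceedances N Q C t \<omega>)"
proof (cases "exceedances N Q C t \<omega> = {}")
  case True
  then show ?thesis by (simp add: gamma_def)
next
  case False
  let ?E = "exceedances N Q C t \<omega>"
  let ?m = "\<lambda>i. i \<in> ?E \<and> (\<forall>j\<in>?E. j = i \<or> label_less i j)"
  have m_iff: "?m i \<longleftrightarrow> i \<in> ?E \<and> (\<forall>j. label_less j i \<longrightarrow> j \<notin> ?E)" for i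
    using label_less_asym label_less_linear by metis
  obtain z where "z \<in> ?E" "\<And>y. (y, z) \<in> lenlex less_than \<Longrightarrow> y \<notin> ?E"
    using False wfE_min'[OF wf_lenlex[OF wf_less_than], of ?E] by blast
  then have z: "?m z" unfolding m_iff by (simp add: label_less_def)
  have uniq: "i = z" if "?m i" for i
    using that z label_less_asym by metis
  have the_z: "(THE i. ?m i) = z"
    using z uniq by (rule the_equality)
  have "gamma N Q C t \<omega> = Some z"
    unfolding gamma_def the_z using False by simp
  then have "gamma N Q C t \<omega> = Some i \<longleftrightarrow> ?m i"
    using z uniq[of i] by auto
  then show ?thesis unfolding m_iff .
qed

lemma gamma_exists: "exceedances N Q C t \<omega> \<noteq> {} \<longleftrightarrow> (\<exists>i. gamma N Q C t \<omega> = Some i)"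
  by (auto simp: gamma_def)

lemma W_greater_iff: "W N Q C \<omega> > ereal t \<longleftrightarrow> (\<exists>i\<in>labels. gamma N Q C t \<omega> = Some i)"
proof -
  have "W N Q C \<omega> > ereal t \<longleftrightarrow> exceedances N Q C t \<omega> \<noteq> {}"
    by (auto simp: W_def less_SUP_iff exceedances_def)
  also have "\<dots> \<longleftrightarrow> (\<exists>i\<in>labels. gamma N Q C t \<omega> = Some i)"
    unfolding gamma_exists by (auto simp: gamma_eq_Some_iff exceedances_def dest: tree_labels)
  finally show ?thesis .
qed

lemma exceedance_weight_nonzero:
  assumes "i \<in> exceedances N Q C t \<omega>"
  shows "weight C i \<omega> \<noteq> 0"
proof
  assume "weight C i \<omega> = 0"
  then have "S C i \<omega> + Y Q i \<omega> = -\<infinity>"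
    by (auto simp: S_def Y_def elog_def)
  with assms show False by (simp add: exceedances_def)
qed

text \<open>The part of the payoff that is contributed by \<open>\<gamma>(t) = i\<close>, without the condition that the spine
  runs through \<open>i\<close>. It is a function of the tree alone.\<close>

definition payoff_at ::
  "real \<Rightarrow> (nat list \<Rightarrow> 'a \<Rightarrow> enat) \<Rightarrow> (nat list \<Rightarrow> 'a \<Rightarrow> real) \<Rightarrow> (nat list \<Rightarrow> 'a \<Rightarrow> real) \<Rightarrow>
   real \<Rightarrow> nat list \<Rightarrow> 'a \<Rightarrow> ennreal" where
  "payoff_at \<alpha> N Q C t i \<omega> =
     of_bool (gamma N Q C t \<omega> = Some i) *
     ennreal (exp (- \<alpha> * (real_of_ereal (S C i \<omega>) - t))) * inverse (D \<alpha> N C i \<omega>)"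

text \<open>At most one summand, the one of \<open>g = \<gamma>(t)\<close>, is nonzero. If the spine visits \<open>g\<close>, then it visits no
  exceedance before, since labels of smaller length precede \<open>g\<close>; hence \<open>\<tau>(t) = |g|\<close>.\<close>

lemma hitting_payoff_eq:
  assumes J: "\<And>k. J k \<omega> \<in> generation N k \<omega>"
  shows "hitting_payoff \<alpha> N Q C J t \<omega> =
    (\<integral>\<^sup>+i. of_bool (J (length i) \<omega> = i) * payoff_at \<alpha> N Q C t i \<omega> \<partial>count_space labels)"
    (is "_ = ?R")
proof (cases "gamma N Q C t \<omega>")
  case None
  then show ?thesis
    by (simp add: hitting_payoff_def payoff_at_def split: enat.split)
next
  case (Some g)
  have g: "g \<in> exceedances N Q C t \<omega>" "g \<in> labels"
    and min: "\<And>j. label_less j g \<Longrightarrow> j \<notin> exceedances N Q C t \<omega>"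
    using Some by (auto simp: gamma_eq_Some_iff exceedances_def dest: tree_labels)
  have "?R = (\<integral>\<^sup>+i. of_bool (J (length g) \<omega> = g) * payoff_at \<alpha> N Q C t g \<omega> * indicator {g} i
      \<partial>count_space labels)"
    by (intro nn_integral_cong) (auto simp: payoff_at_def Some indicator_def)
  also have "\<dots> = of_bool (J (length g) \<omega> = g) * payoff_at \<alpha> N Q C t g \<omega>"
    using g by (subst nn_integral_cmult_indicator) auto
  finally have R: "?R = of_bool (J (length g) \<omega> = g) * payoff_at \<alpha> N Q C t g \<omega>" .
  show ?thesis
  proof (cases "J (length g) \<omega> = g")
    case True
    have exc: "V C J s \<omega> + xi Q J s \<omega> > ereal t \<longleftrightarrow> J s \<omega> \<in> exceedances N Q C t \<omega>" for s
      using J[of s] by (auto simp: V_def xi_def exceedances_def generation_iff_tree)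
    have len: "length (J s \<omega>) = s" for s
      using J[of s] by (rule generation_length)
    have "length g \<le> s" if "J s \<omega> \<in> exceedances N Q C t \<omega>" for s
      using min[OF label_less_shorter, of "J s \<omega>"] that len[of s] by fastforce
    then have "tau Q C J t \<omega> = enat (length g)"
      unfolding tau_def exc using True g
      by (intro cInf_eq_minimum) auto
    then show ?thesis
      unfolding R using True by (simp add: hitting_payoff_def payoff_at_def V_def Some)
  next
    case False
    then have "g \<noteq> J k \<omega>" for k
      using J[of k] by (auto dest: generation_length)
    then show ?thesis
      unfolding R using False by (auto simp: hitting_payoff_def Some split: enat.split)
  qed
qed


section \<open>Measurability\<close>

text \<open>The quantity \<open>D\<^sub>i\<close> as a function of the vector \<open>\<psi>\<^sub>i\<close>, through which both its measurability and its
  law are obtained.\<close>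

definition branch_alpha :: "real \<Rightarrow> bvec \<Rightarrow> ennreal" where
  "branch_alpha \<alpha> v = branch_sum (fst v) (\<lambda>r. ennreal (snd (snd v) r powr \<alpha>))"

lemma bvec_branch_alpha:
  "branch_alpha \<alpha> (bvec n q c) = branch_sum n (\<lambda>r. ennreal (c r powr \<alpha>))"
  by (auto simp: branch_alpha_def bvec_def branch_sum_def branch_term_def intro!: arg_cong[where f=suminf])

lemma D_eq: "D \<alpha> N C i \<omega> = branch_alpha \<alpha> (psi N Q C i \<omega>)"
  by (simp add: psi_def bvec_branch_alpha D_def)

lemma bvec_fst [measurable]: "fst \<in> bvec_space \<rightarrow>\<^sub>M count_space UNIV"
  unfolding bvec_space_def by measurable

lemma bvec_fst_snd [measurable]: "(\<lambda>v. fst (snd v)) \<in> borel_measurable bvec_space"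
  unfolding bvec_space_def by measurable

lemma bvec_coord: "1 \<le> j \<Longrightarrow> (\<lambda>v. snd (snd v) j) \<in> borel_measurable bvec_space"
proof -
  assume "1 \<le> j"
  then have "(\<lambda>c. c j) \<in> borel_measurable (Pi\<^sub>M {1..} (\<lambda>_. borel :: real measure))"
    by (intro measurable_component_singleton) simp
  from measurable_compose[OF measurable_compose[OF measurable_snd measurable_snd] this]
  show ?thesis unfolding bvec_space_def .
qed

lemma bvec_in_space: "bvec n q c \<in> space bvec_space"
  by (auto simp: bvec_space_def bvec_def space_pair_measure space_PiM)

lemma branch_alpha_measurable [measurable]: "branch_alpha \<alpha> \<in> borel_measurable bvec_space"
proof -
  have [measurable]: "(\<lambda>v. snd (snd v) (Suc j)) \<in> borel_measurable bvec_space" for j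
    by (rule bvec_coord) simp
  show ?thesis
    unfolding branch_alpha_def branch_sum_def branch_term_def by measurable
qed

lemma nonneg_coord_sets: "{v \<in> space bvec_space. \<forall>j\<ge>1. 0 \<le> snd (snd v) j} \<in> sets bvec_space"
proof -
  have eq: "(\<forall>j\<ge>1. 0 \<le> snd (snd v) j) \<longleftrightarrow> (\<forall>j. 0 \<le> snd (snd v) (Suc j))" for v :: bvec
    by (auto simp: Suc_le_eq gr0_conv_Suc)
  have [measurable]: "(\<lambda>v. snd (snd v) (Suc j)) \<in> borel_measurable bvec_space" for j
    by (rule bvec_coord) simp
  show ?thesis unfolding eq by measurable
qed

lemma elog_measurable [measurable]: "elog \<in> borel_measurable borel"
  unfolding elog_def by measurable

text \<open>The next facts hold for any \<open>\<sigma>\<close>-algebra that contains the information of the vectors up to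
  generation \<open>k\<close>. They are applied to the whole space, to the past of the spine and, after
  truncation to the tree, to \<open>G\<^bsub>k+1\<^esub>\<close>.\<close>

context
  fixes X :: "'a measure"
    and N :: "nat list \<Rightarrow> 'a \<Rightarrow> enat"
    and Q :: "nat list \<Rightarrow> 'a \<Rightarrow> real"
    and C :: "nat list \<Rightarrow> 'a \<Rightarrow> real"
    and k :: nat
  assumes psi_meas: "\<And>i. i \<in> labels \<Longrightarrow> length i \<le> k \<Longrightarrow> psi N Q C i \<in> X \<rightarrow>\<^sub>M bvec_space"
begin

lemma N_measurable: "i \<in> labels \<Longrightarrow> length i \<le> k \<Longrightarrow> N i \<in> X \<rightarrow>\<^sub>M count_space UNIV"
  using measurable_compose[OF psi_meas bvec_fst, of i] by (simp add: psi_def bvec_def)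

lemma Q_measurable: "i \<in> labels \<Longrightarrow> length i \<le> k \<Longrightarrow> Q i \<in> borel_measurable X"
  using measurable_compose[OF psi_meas bvec_fst_snd, of i] by (simp add: psi_def bvec_def)

lemma C_measurable:
  "i \<in> labels \<Longrightarrow> length i \<le> k \<Longrightarrow> 1 \<le> j \<Longrightarrow> C (i @ [j]) \<in> borel_measurable X"
  using measurable_compose[OF psi_meas bvec_coord, of i j] by (simp add: psi_def bvec_def)

lemma D_measurable: "i \<in> labels \<Longrightarrow> length i \<le> k \<Longrightarrow> D \<alpha> N C i \<in> borel_measurable X"
  using measurable_compose[OF psi_meas branch_alpha_measurable, of i \<alpha>] D_eq[of \<alpha> N C i _ Q]
  by (metis (no_types, lifting) measurable_cong)

lemma tree_measurable: "i \<in> labels \<Longrightarrow> length i \<le> k \<Longrightarrow> Measurable.pred X (\<lambda>\<omega>. i \<in> tree N \<omega>)"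
proof (induction i rule: rev_induct)
  case Nil
  show ?case by simp
next
  case (snoc j i)
  then have [measurable]: "Measurable.pred X (\<lambda>\<omega>. i \<in> tree N \<omega>)" "N i \<in> X \<rightarrow>\<^sub>M count_space UNIV"
    by (auto intro: N_measurable)
  show ?case unfolding tree_snoc by measurable
qed

lemma weight_measurable: "i \<in> labels \<Longrightarrow> length i \<le> k \<Longrightarrow> weight C i \<in> borel_measurable X"
proof (induction i rule: rev_induct)
  case Nil
  show ?case by (simp add: weight_Nil)
next
  case (snoc j i)
  then have [measurable]: "weight C i \<in> borel_measurable X" "C (i @ [j]) \<in> borel_measurable X"
    by (auto intro: C_measurable)
  show ?case unfolding weight_snoc by measurable
qed

lemma S_measurable: "i \<in> labels \<Longrightarrow> length i \<le> k \<Longrightarrow> S C i \<in> borel_measurable X"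
  unfolding S_def using weight_measurable by measurable

lemma exceedances_measurable:
  assumes "i \<in> labels" "length i \<le> k"
  shows "Measurable.pred X (\<lambda>\<omega>. i \<in> exceedances N Q C t \<omega>)"
proof -
  note [measurable] = S_measurable[OF assms] Q_measurable[OF assms] tree_measurable[OF assms]
  show ?thesis unfolding exceedances_def Y_def by measurable
qed

text \<open>Labels that precede \<open>i\<close> are not longer than \<open>i\<close>, so that \<open>\<gamma>(t) = i\<close> is decided by the first
  \<open>|i|\<close> generations.\<close>

lemma gamma_measurable:
  assumes "i \<in> labels" "length i \<le> k"
  shows "Measurable.pred X (\<lambda>\<omega>. gamma N Q C t \<omega> = Some i)"
proof -
  have [measurable]: "Measurable.pred X (\<lambda>\<omega>. i \<in> exceedances N Q C t \<omega>)"
    using assms by (rule exceedances_measurable)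
  have [measurable]: "Measurable.pred X (\<lambda>\<omega>. label_less j i \<longrightarrow> j \<notin> exceedances N Q C t \<omega>)" for j
  proof (cases "label_less j i \<and> j \<in> labels")
    case True
    then have "Measurable.pred X (\<lambda>\<omega>. j \<in> exceedances N Q C t \<omega>)"
      using assms label_less_length by (intro exceedances_measurable) fastforce+
    then show ?thesis by measurable
  next
    case False
    then have "(\<lambda>\<omega>. label_less j i \<longrightarrow> j \<notin> exceedances N Q C t \<omega>) = (\<lambda>\<omega>. True)"
      by (auto simp: exceedances_def dest: tree_labels)
    then show ?thesis by simp
  qed
  show ?thesis unfolding gamma_eq_Some_iff by measurable
qed

lemma payoff_at_measurable:
  assumes "i \<in> labels" "length i \<le> k"
  shows "payoff_at \<alpha> N Q C t i \<in> borel_measurable X"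
proof -
  note [measurable] = S_measurable[OF assms] gamma_measurable[OF assms] D_measurable[OF assms]
  show ?thesis unfolding payoff_at_def of_bool_def by measurable
qed

end



section \<open>Truncation to the tree and the filtration\<close>

text \<open>The \<open>\<sigma>\<close>-algebra \<open>F\<^sub>k\<close> contains the vector of a node only on the event that the node belongs to
  the tree, so \<open>N i\<close>, \<open>Q i\<close>, \<open>C i\<close> themselves are not measurable with respect to it. Replacing the
  vectors of all other nodes by \<open>0\<close> makes them measurable (\<open>psi_trunc_G_alg\<close>) without changing the
  tree, the exceedances, or the payoff (\<open>payoff_at_trunc\<close>). The weights \<open>C (i, j)\<close> belong to the
  vector of the parent \<open>i\<close>, hence the \<^const>\<open>butlast\<close>.\<close>

definition N_trunc :: "(nat list \<Rightarrow> 'a \<Rightarrow> enat) \<Rightarrow> nat list \<Rightarrow> 'a \<Rightarrow> enat" where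
  "N_trunc N i \<omega> = (if i \<in> tree N \<omega> then N i \<omega> else 0)"

definition Q_trunc ::
  "(nat list \<Rightarrow> 'a \<Rightarrow> enat) \<Rightarrow> (nat list \<Rightarrow> 'a \<Rightarrow> real) \<Rightarrow> nat list \<Rightarrow> 'a \<Rightarrow> real" where
  "Q_trunc N Q i \<omega> = (if i \<in> tree N \<omega> then Q i \<omega> else 0)"

definition C_trunc ::
  "(nat list \<Rightarrow> 'a \<Rightarrow> enat) \<Rightarrow> (nat list \<Rightarrow> 'a \<Rightarrow> real) \<Rightarrow> nat list \<Rightarrow> 'a \<Rightarrow> real" where
  "C_trunc N C i \<omega> = (if butlast i \<in> tree N \<omega> then C i \<omega> else 0)"

lemma psi_trunc:
  "psi (N_trunc N) (Q_trunc N Q) (C_trunc N C) i \<omega> =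
     (if i \<in> tree N \<omega> then psi N Q C i \<omega> else bvec 0 0 (\<lambda>_. 0))"
  by (simp add: psi_def N_trunc_def Q_trunc_def C_trunc_def)

lemma tree_trunc [simp]: "tree (N_trunc N) \<omega> = tree N \<omega>"
proof -
  have "i \<in> tree (N_trunc N) \<omega> \<longleftrightarrow> i \<in> tree N \<omega>" for i
    by (induction i rule: rev_induct) (auto simp: N_trunc_def)
  then show ?thesis by blast
qed

lemma weight_trunc: "i \<in> tree N \<omega> \<Longrightarrow> weight (C_trunc N C) i \<omega> = weight C i \<omega>"
  by (induction i rule: rev_induct) (auto simp: weight_Nil weight_snoc C_trunc_def)

lemma exceedances_trunc:
  "exceedances (N_trunc N) (Q_trunc N Q) (C_trunc N C) t \<omega> = exceedances N Q C t \<omega>"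
  by (auto simp: exceedances_def S_def Y_def weight_trunc Q_trunc_def)

lemma payoff_at_trunc:
  "payoff_at \<alpha> (N_trunc N) (Q_trunc N Q) (C_trunc N C) t i \<omega> = payoff_at \<alpha> N Q C t i \<omega>"
proof -
  have gam: "gamma (N_trunc N) (Q_trunc N Q) (C_trunc N C) t \<omega> = gamma N Q C t \<omega>"
    by (simp add: gamma_def exceedances_trunc)
  show ?thesis
  proof (cases "gamma N Q C t \<omega> = Some i")
    case True
    then have i: "i \<in> tree N \<omega>"
      by (simp add: gamma_eq_Some_iff exceedances_def)
    then have "psi (N_trunc N) (Q_trunc N Q) (C_trunc N C) i \<omega> = psi N Q C i \<omega>"
      by (simp add: psi_trunc)
    then have "D \<alpha> (N_trunc N) (C_trunc N C) i \<omega> = D \<alpha> N C i \<omega>"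
      by (metis D_eq)
    then show ?thesis
      using i by (simp add: payoff_at_def gam S_def weight_trunc)
  qed (simp add: payoff_at_def gam)
qed

lemma space_F_alg [simp]: "space (F_alg M N Q C k) = space M"
  by (simp add: F_alg_def space_measure_of_conv)

lemma space_G_alg [simp]: "space (G_alg M N Q C J k) = space M"
  by (simp add: G_alg_def space_measure_of_conv)

lemma space_spine_past [simp]: "space (spine_past M N Q C J k) = space M"
  by (simp add: spine_past_def space_measure_of_conv)

lemma sets_spine_past:
  "sets (spine_past M N Q C J k) = sigma_sets (space M)
     ({psi N Q C i -` B \<inter> space M | i B. i \<in> labels \<and> B \<in> sets bvec_space} \<union>
      {J s -` {i} \<inter> space M | s i. s \<le> k})"
  unfolding spine_past_def by (rule sets_measure_of) auto

lemma sets_F_alg: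
  "sets (F_alg M N Q C k) = sigma_sets (space M)
     {{\<omega> \<in> space M. i \<in> generation N s \<omega> \<and> psi N Q C i \<omega> \<in> B} | i s B.
        s < k \<and> i \<in> labels \<and> B \<in> sets bvec_space}"
  unfolding F_alg_def by (rule sets_measure_of) auto

lemma sets_G_alg:
  "sets (G_alg M N Q C J k) = sigma_sets (space M)
     (sets (F_alg M N Q C k) \<union> {J s -` {i} \<inter> space M | s i. s \<le> k})"
  unfolding G_alg_def
  using sets.sets_into_space[of _ "F_alg M N Q C k"] by (intro sets_measure_of) auto

lemma psi_spine_past:
  "i \<in> labels \<Longrightarrow> psi N Q C i \<in> spine_past M N Q C J k \<rightarrow>\<^sub>M bvec_space"
  by (rule measurableI)
     (auto simp: sets_spine_past psi_def bvec_in_space intro!: sigma_sets.Basic)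

lemma J_spine_past:
  assumes "s \<le> k"
  shows "Measurable.pred (spine_past M N Q C J k) (\<lambda>\<omega>. J s \<omega> = i)"
proof -
  have "{\<omega> \<in> space M. J s \<omega> = i} = J s -` {i} \<inter> space M" by auto
  then show ?thesis
    using assms unfolding pred_def space_spine_past sets_spine_past
    by (intro sigma_sets.Basic UnI2) auto
qed

lemma J_G_alg:
  assumes "s \<le> k"
  shows "Measurable.pred (G_alg M N Q C J k) (\<lambda>\<omega>. J s \<omega> = i)"
proof -
  have "{\<omega> \<in> space M. J s \<omega> = i} = J s -` {i} \<inter> space M" by auto
  then show ?thesis
    using assms by (auto simp: pred_def sets_G_alg intro!: sigma_sets.Basic)
qed

lemma generation_psi_G_alg:
  assumes "i \<in> labels" "length i < k" "B \<in> sets bvec_space"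
  shows "{\<omega> \<in> space M. i \<in> tree N \<omega> \<and> psi N Q C i \<omega> \<in> B} \<in> sets (G_alg M N Q C J k)"
proof -
  have "{\<omega> \<in> space M. i \<in> tree N \<omega> \<and> psi N Q C i \<omega> \<in> B} =
        {\<omega> \<in> space M. i \<in> generation N (length i) \<omega> \<and> psi N Q C i \<omega> \<in> B}"
    by (simp add: generation_iff_tree)
  also have "\<dots> \<in> sets (F_alg M N Q C k)"
    unfolding sets_F_alg using assms by (intro sigma_sets.Basic) blast
  finally show ?thesis
    unfolding sets_G_alg by (intro sigma_sets.Basic) blast
qed

lemma tree_G_alg:
  assumes "i \<in> labels" "length i < k"
  shows "Measurable.pred (G_alg M N Q C J k) (\<lambda>\<omega>. i \<in> tree N \<omega>)"
  using generation_psi_G_alg[OF assms sets.top, where ?M=M and ?N=N and ?Q=Q and ?C=C and ?J=J]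
  by (simp add: pred_def psi_def bvec_in_space)

lemma psi_trunc_G_alg:
  assumes "i \<in> labels" "length i < k"
  shows "psi (N_trunc N) (Q_trunc N Q) (C_trunc N C) i \<in> G_alg M N Q C J k \<rightarrow>\<^sub>M bvec_space"
proof (rule measurableI)
  fix B assume B: "B \<in> sets bvec_space"
  let ?T = "\<lambda>\<omega>. i \<in> tree N \<omega>"
  have [measurable]: "Measurable.pred (G_alg M N Q C J k) ?T"
      "Measurable.pred (G_alg M N Q C J k) (\<lambda>\<omega>. ?T \<omega> \<and> psi N Q C i \<omega> \<in> B)"
    using tree_G_alg[OF assms] generation_psi_G_alg[OF assms B] by (auto simp: pred_def)
  have "psi (N_trunc N) (Q_trunc N Q) (C_trunc N C) i -` B \<inter> space (G_alg M N Q C J k) =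
    {\<omega> \<in> space (G_alg M N Q C J k). (?T \<omega> \<and> psi N Q C i \<omega> \<in> B) \<or>
      (\<not> ?T \<omega> \<and> bvec 0 0 (\<lambda>_. 0) \<in> B)}"
    by (auto simp: psi_trunc split: if_splits)
  also have "\<dots> \<in> sets (G_alg M N Q C J k)"
    by measurable
  finally show "psi (N_trunc N) (Q_trunc N Q) (C_trunc N C) i -` B \<inter> space (G_alg M N Q C J k)
      \<in> sets (G_alg M N Q C J k)" .
qed (auto simp: psi_def bvec_in_space)

lemma payoff_at_G_alg:
  assumes "i \<in> labels" "length i < k"
  shows "payoff_at \<alpha> N Q C t i \<in> borel_measurable (G_alg M N Q C J k)"
proof -
  have "payoff_at \<alpha> (N_trunc N) (Q_trunc N Q) (C_trunc N C) t i
      \<in> borel_measurable (G_alg M N Q C J k)"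
    using assms by (intro payoff_at_measurable[where k="length i"] psi_trunc_G_alg) auto
  then show ?thesis by (simp add: payoff_at_trunc[abs_def])
qed


section \<open>The law of the spine given the tree\<close>

text \<open>The conditional probability that the spine moves from \<open>i\<close> to \<open>(i, j)\<close>, given all vectors.\<close>

definition step_prob ::
  "real \<Rightarrow> (nat list \<Rightarrow> 'a \<Rightarrow> enat) \<Rightarrow> (nat list \<Rightarrow> 'a \<Rightarrow> real) \<Rightarrow> nat list \<Rightarrow> nat \<Rightarrow> 'a \<Rightarrow> ennreal" where
  "step_prob \<alpha> N C i j \<omega> =
     (if enat j \<le> N i \<omega> then ennreal (C (i @ [j]) \<omega> powr \<alpha>) / D \<alpha> N C i \<omega> else 0)"

definition path_prob ::
  "real \<Rightarrow> (nat list \<Rightarrow> 'a \<Rightarrow> enat) \<Rightarrow> (nat list \<Rightarrow> 'a \<Rightarrow> real) \<Rightarrow> nat list \<Rightarrow> 'a \<Rightarrow> ennreal" where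
  "path_prob \<alpha> N C i \<omega> = (\<Prod>r<length i. step_prob \<alpha> N C (take r i) (i ! r) \<omega>)"

text \<open>The density \<open>L\<^bsub>|i|\<^esub>\<close> on the event that the spine runs through \<open>i\<close>.\<close>

definition path_D ::
  "real \<Rightarrow> (nat list \<Rightarrow> 'a \<Rightarrow> enat) \<Rightarrow> (nat list \<Rightarrow> 'a \<Rightarrow> real) \<Rightarrow> nat list \<Rightarrow> 'a \<Rightarrow> ennreal" where
  "path_D \<alpha> N C i \<omega> = (\<Prod>r<length i. D \<alpha> N C (take r i) \<omega>)"

lemma path_prob_Nil: "path_prob \<alpha> N C [] \<omega> = 1"
  by (simp add: path_prob_def)

lemma path_prob_snoc:
  "path_prob \<alpha> N C (i @ [j]) \<omega> = step_prob \<alpha> N C i j \<omega> * path_prob \<alpha> N C i \<omega>"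
  by (simp add: path_prob_def nth_append mult.commute)

lemma path_D_Nil: "path_D \<alpha> N C [] \<omega> = 1"
  by (simp add: path_D_def)

lemma path_D_snoc: "path_D \<alpha> N C (i @ [j]) \<omega> = D \<alpha> N C i \<omega> * path_D \<alpha> N C i \<omega>"
  by (simp add: path_D_def mult.commute)

text \<open>Each step contributes \<open>D \<cdot> C\<^sup>\<alpha> / D = C\<^sup>\<alpha>\<close>, which is legitimate since \<open>0 < D < \<infinity>\<close>. Nonnegativity of the
  weights makes \<open>powr\<close> multiplicative.\<close>

lemma path_D_times_path_prob:
  assumes "i \<in> tree N \<omega>"
    and D: "\<And>i. i \<in> labels \<Longrightarrow> D \<alpha> N C i \<omega> \<noteq> 0 \<and> D \<alpha> N C i \<omega> \<noteq> \<infinity>"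
    and C: "\<And>i j. i \<in> labels \<Longrightarrow> 1 \<le> j \<Longrightarrow> 0 \<le> C (i @ [j]) \<omega>"
  shows "path_D \<alpha> N C i \<omega> * path_prob \<alpha> N C i \<omega> = ennreal (weight C i \<omega> powr \<alpha>) \<and> 0 \<le> weight C i \<omega>"
  using assms(1)
proof (induction i rule: rev_induct)
  case Nil
  show ?case by (simp add: path_D_Nil path_prob_Nil weight_Nil)
next
  case (snoc j i)
  then have i: "i \<in> tree N \<omega>" "1 \<le> j" "enat j \<le> N i \<omega>" "i \<in> labels"
    by (auto dest: tree_labels)
  note IH = snoc.IH[OF i(1)]
  let ?c = "C (i @ [j]) \<omega>" and ?D = "D \<alpha> N C i \<omega>"
  have c: "0 \<le> ?c" using C i by simp
  have "?D * (ennreal (?c powr \<alpha>) / ?D) = ennreal (?c powr \<alpha>)"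
    using D[OF i(4)] by (simp add: ennreal_times_divide mult.commute[of ?D] mult_divide_eq_ennreal)
  moreover have "path_D \<alpha> N C (i @ [j]) \<omega> * path_prob \<alpha> N C (i @ [j]) \<omega> =
      ?D * (ennreal (?c powr \<alpha>) / ?D) * (path_D \<alpha> N C i \<omega> * path_prob \<alpha> N C i \<omega>)"
    using i by (simp only: path_D_snoc path_prob_snoc step_prob_def if_True mult_ac)
  ultimately have "path_D \<alpha> N C (i @ [j]) \<omega> * path_prob \<alpha> N C (i @ [j]) \<omega> =
      ennreal (?c powr \<alpha>) * (path_D \<alpha> N C i \<omega> * path_prob \<alpha> N C i \<omega>)"
    by simp
  also have "\<dots> = ennreal (weight C (i @ [j]) \<omega> powr \<alpha>)"
    using IH c by (simp add: weight_snoc powr_mult ennreal_mult)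
  finally show ?case using IH c by (simp add: weight_snoc)
qed

text \<open>The transition probabilities of the spine sum to \<open>D / D = 1\<close>, so the spine does move to a child.\<close>

lemma suminf_step_prob:
  assumes "D \<alpha> N C i \<omega> \<noteq> 0" "D \<alpha> N C i \<omega> \<noteq> \<infinity>"
  shows "(\<Sum>j. step_prob \<alpha> N C i (Suc j) \<omega>) = 1"
proof -
  have "step_prob \<alpha> N C i (Suc j) \<omega> =
      branch_term (N i \<omega>) (\<lambda>r. ennreal (C (i @ [r]) \<omega> powr \<alpha>)) j / D \<alpha> N C i \<omega>" for j
    by (simp add: step_prob_def branch_term_def)
  then have "(\<Sum>j. step_prob \<alpha> N C i (Suc j) \<omega>) = D \<alpha> N C i \<omega> / D \<alpha> N C i \<omega>"
    by (simp add: D_def branch_sum_def)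
  with assms show ?thesis by (simp add: less_top)
qed

text \<open>The setting in which the identity is proved: a family of branching vectors with \<open>0 < D\<^sub>i < \<infinity>\<close> and
  nonnegative weights almost surely, together with its spine.\<close>

locale spine_tree = prob_space M
  for M :: "'a measure" +
  fixes N :: "nat list \<Rightarrow> 'a \<Rightarrow> enat"
    and Q :: "nat list \<Rightarrow> 'a \<Rightarrow> real"
    and C :: "nat list \<Rightarrow> 'a \<Rightarrow> real"
    and J :: "nat \<Rightarrow> 'a \<Rightarrow> nat list"
    and \<alpha> :: real
  assumes psi_M: "\<And>i. i \<in> labels \<Longrightarrow> psi N Q C i \<in> M \<rightarrow>\<^sub>M bvec_space"
    and D_AE: "\<And>i. i \<in> labels \<Longrightarrow> AE \<omega> in M. D \<alpha> N C i \<omega> \<noteq> 0 \<and> D \<alpha> N C i \<omega> \<noteq> \<infinity>"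
    and C_AE: "\<And>i. i \<in> labels \<Longrightarrow> AE \<omega> in M. \<forall>j\<ge>1. 0 \<le> C (i @ [j]) \<omega>"
    and spine: "is_spine M \<alpha> N Q C J"
begin

abbreviation "Past \<equiv> spine_past M N Q C J"
abbreviation "G \<equiv> G_alg M N Q C J"

lemma J_M [measurable]: "J k \<in> M \<rightarrow>\<^sub>M count_space UNIV"
  using spine by (simp add: is_spine_def)

lemma J_0: "\<omega> \<in> space M \<Longrightarrow> J 0 \<omega> = []"
  using spine by (simp add: is_spine_def)

lemma J_singleton_M: "J k -` {i} \<inter> space M \<in> sets M"
  by (rule measurable_sets[OF J_M]) simp

lemma subalgebra_Past: "subalgebra M (Past k)"
proof -
  have "sets (Past k) \<subseteq> sets M"
    unfolding sets_spine_past
    using J_singleton_M measurable_sets[OF psi_M]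
    by (intro sets.sigma_sets_subset) auto
  then show ?thesis by (simp add: subalgebra_def)
qed

lemma N_Past: "i \<in> labels \<Longrightarrow> N i \<in> Past k \<rightarrow>\<^sub>M count_space UNIV"
  by (rule N_measurable[where k="length i", OF psi_spine_past]) auto

lemma C_Past: "i \<in> labels \<Longrightarrow> 1 \<le> j \<Longrightarrow> C (i @ [j]) \<in> borel_measurable (Past k)"
  by (rule C_measurable[where k="length i", OF psi_spine_past]) auto

lemma D_Past: "i \<in> labels \<Longrightarrow> D \<alpha> N C i \<in> borel_measurable (Past k)"
  by (rule D_measurable[where k="length i", OF psi_spine_past]) auto

lemma step_prob_Past:
  assumes "i \<in> labels" "1 \<le> j"
  shows "step_prob \<alpha> N C i j \<in> borel_measurable (Past k)"
proof -
  note [measurable] = N_Past[OF assms(1)] C_Past[OF assms] D_Past[OF assms(1)]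
  show ?thesis unfolding step_prob_def by measurable
qed

lemmas Past_M = measurable_from_subalg[OF subalgebra_Past]

lemma gamma_M: "i \<in> labels \<Longrightarrow> Measurable.pred M (\<lambda>\<omega>. gamma N Q C t \<omega> = Some i)"
  by (rule gamma_measurable[where k="length i", OF psi_M]) auto

text \<open>The defining property of conditional expectations, with the test function \<open>F 1(J\<^sub>k = i)\<close>.\<close>

lemma spine_step:
  assumes i: "i \<in> labels" and j: "1 \<le> j" and F: "F \<in> borel_measurable (Past k)"
  shows "(\<integral>\<^sup>+\<omega>. F \<omega> * of_bool (J k \<omega> = i \<and> J (Suc k) \<omega> = i @ [j]) \<partial>M) =
         (\<integral>\<^sup>+\<omega>. F \<omega> * step_prob \<alpha> N C i j \<omega> * of_bool (J k \<omega> = i) \<partial>M)"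
proof -
  interpret sub: sigma_finite_subalgebra M "Past k"
    by (intro finite_measure_subalgebra_is_sigma_finite finite_measure_subalgebra.intro
          finite_measure_axioms finite_measure_subalgebra_axioms.intro subalgebra_Past)
  let ?f = "\<lambda>\<omega>. F \<omega> * of_bool (J k \<omega> = i)"
  let ?B = "{\<omega> \<in> space M. J (Suc k) \<omega> = J k \<omega> @ [j]}"
  have "Measurable.pred (Past k) (\<lambda>\<omega>. J k \<omega> = i)"
    by (rule J_spine_past) simp
  with F have f: "?f \<in> borel_measurable (Past k)"
    unfolding of_bool_def by measurable
  have B: "?B \<in> sets M"
    by measurable
  have AE_step: "AE \<omega> in M. nn_cond_exp M (Past k) (indicator ?B) \<omega> = step_prob \<alpha> N C (J k \<omega>) j \<omega>"
    using spine j unfolding is_spine_def step_prob_def by blast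
  have "(\<integral>\<^sup>+\<omega>. F \<omega> * of_bool (J k \<omega> = i \<and> J (Suc k) \<omega> = i @ [j]) \<partial>M) =
        (\<integral>\<^sup>+\<omega>. ?f \<omega> * indicator ?B \<omega> \<partial>M)"
    by (intro nn_integral_cong) (auto simp: indicator_def)
  also have "\<dots> = (\<integral>\<^sup>+\<omega>. ?f \<omega> * nn_cond_exp M (Past k) (indicator ?B) \<omega> \<partial>M)"
    using f B by (intro sub.nn_cond_exp_intg[symmetric]) auto
  also have "\<dots> = (\<integral>\<^sup>+\<omega>. F \<omega> * step_prob \<alpha> N C i j \<omega> * of_bool (J k \<omega> = i) \<partial>M)"
    by (rule nn_integral_cong_AE) (use AE_step in eventually_elim, auto)
  finally show ?thesis .
qed

text \<open>The conditions defining the spine prescribe the conditional probabilities of its moves but not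
  that it stays in the tree. This follows because the events that the spine moves from \<open>i\<close> to an
  offspring \<open>(i, j)\<close> are disjoint subevents of \<open>J\<^sub>k = i\<close> whose probabilities add up to \<open>P(J\<^sub>k = i)\<close>.\<close>

lemma spine_child:
  assumes i: "i \<in> labels"
  shows "AE \<omega> in M. J k \<omega> = i \<longrightarrow>
    (\<exists>j\<ge>1. enat j \<le> N i \<omega> \<and> J (Suc k) \<omega> = i @ [j])"
proof -
  let ?H = "{\<omega> \<in> space M. J k \<omega> = i}"
  let ?A = "\<lambda>j. {\<omega> \<in> space M. J k \<omega> = i \<and> J (Suc k) \<omega> = i @ [Suc j] \<and> enat (Suc j) \<le> N i \<omega>}"
  have [measurable]: "N i \<in> M \<rightarrow>\<^sub>M count_space UNIV"
    by (rule Past_M[OF N_Past[OF i]])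
  have [measurable]: "step_prob \<alpha> N C i (Suc j) \<in> borel_measurable M" for j
    by (rule Past_M[OF step_prob_Past[OF i]]) simp
  have A: "?A j \<in> sets M" for j by measurable
  have H: "?H \<in> sets M" by measurable
  have emA: "emeasure M (?A j) =
      (\<integral>\<^sup>+\<omega>. step_prob \<alpha> N C i (Suc j) \<omega> * of_bool (J k \<omega> = i) \<partial>M)" for j
  proof -
    let ?F = "\<lambda>\<omega>. of_bool (enat (Suc j) \<le> N i \<omega>) :: ennreal"
    have [measurable]: "N i \<in> Past k \<rightarrow>\<^sub>M count_space UNIV" by (rule N_Past[OF i])
    have F: "?F \<in> borel_measurable (Past k)" unfolding of_bool_def by measurable
    have "emeasure M (?A j) = (\<integral>\<^sup>+\<omega>. indicator (?A j) \<omega> \<partial>M)"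
      by (rule nn_integral_indicator[OF A, symmetric])
    also have "\<dots> =
        (\<integral>\<^sup>+\<omega>. ?F \<omega> * of_bool (J k \<omega> = i \<and> J (Suc k) \<omega> = i @ [Suc j]) \<partial>M)"
      by (intro nn_integral_cong) (auto simp: indicator_def)
    also have "\<dots> = (\<integral>\<^sup>+\<omega>. ?F \<omega> * step_prob \<alpha> N C i (Suc j) \<omega> * of_bool (J k \<omega> = i) \<partial>M)"
      by (rule spine_step[OF i _ F]) simp
    also have "\<dots> = (\<integral>\<^sup>+\<omega>. step_prob \<alpha> N C i (Suc j) \<omega> * of_bool (J k \<omega> = i) \<partial>M)"
      by (intro nn_integral_cong) (auto simp: step_prob_def)
    finally show ?thesis .
  qed
  have "emeasure M (\<Union>j. ?A j) = (\<Sum>j. emeasure M (?A j))"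
    using A by (intro suminf_emeasure[symmetric]) (auto simp: disjoint_family_on_def)
  also have "\<dots> = (\<integral>\<^sup>+\<omega>. (\<Sum>j. step_prob \<alpha> N C i (Suc j) \<omega> * of_bool (J k \<omega> = i)) \<partial>M)"
    unfolding emA by (rule nn_integral_suminf[symmetric]) (simp add: of_bool_def)
  also have "\<dots> = (\<integral>\<^sup>+\<omega>. indicator ?H \<omega> \<partial>M)"
  proof (rule nn_integral_cong_AE, use D_AE[OF i] AE_space in eventually_elim)
    case (elim \<omega>)
    then show ?case
      using suminf_step_prob[of \<alpha> N C i \<omega>] by (auto simp: indicator_def)
  qed
  also have "\<dots> = emeasure M ?H" using H by simp
  finally have eq: "emeasure M (\<Union>j. ?A j) = emeasure M ?H" .
  have "emeasure M (?H - (\<Union>j. ?A j)) = 0"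
    using A H eq by (subst emeasure_Diff) (auto simp: emeasure_eq_measure)
  then have "AE \<omega> in M. \<omega> \<notin> ?H - (\<Union>j. ?A j)"
    using A H by (intro AE_not_in) (auto simp: null_sets_def)
  with AE_space show ?thesis
    by eventually_elim (auto 4 4)
qed

lemma AE_spine:
  "AE \<omega> in M. \<forall>k. J k \<omega> \<in> generation N k \<omega> \<and> (\<exists>j. J (Suc k) \<omega> = J k \<omega> @ [j])"
proof -
  have "AE \<omega> in M. \<forall>k. \<forall>i\<in>labels. J k \<omega> = i \<longrightarrow>
      (\<exists>j\<ge>1. enat j \<le> N i \<omega> \<and> J (Suc k) \<omega> = i @ [j])"
    unfolding AE_all_countable AE_ball_countable[OF countableI_type] using spine_child by blast
  with AE_space show ?thesis
  proof eventually_elim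
    case (elim \<omega>)
    have gen: "J k \<omega> \<in> generation N k \<omega>" for k
    proof (induction k)
      case 0
      then show ?case using elim J_0 by simp
    next
      case (Suc k)
      from elim(2) generation_labels[OF Suc] Suc show ?case by fastforce
    qed
    with elim(2) generation_labels[OF gen] show ?case by blast
  qed
qed

lemma AE_prefix: "AE \<omega> in M. \<forall>k. \<forall>r\<le>k. J r \<omega> = take r (J k \<omega>)"
  using AE_spine
proof eventually_elim
  case (elim \<omega>)
  then have len: "length (J k \<omega>) = k" for k
    using generation_length[of "J k \<omega>" N k \<omega>] by simp
  have "r \<le> k \<longrightarrow> J r \<omega> = take r (J k \<omega>)" for r k
  proof (induction k)
    case (Suc k)
    from elim obtain j where "J (Suc k) \<omega> = J k \<omega> @ [j]" by blast
    with Suc len[of k] len[of "Suc k"] show ?case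
      by (cases "r = Suc k") auto
  qed (use len[of 0] in simp)
  then show ?case by blast
qed

text \<open>The conditional law of \<open>J\<^bsub>|i|\<^esub>\<close> given all vectors, as a chain of one-step conditionings: the transition
  probability of the last step is again measurable with respect to every past, so it can be absorbed
  into \<open>F\<close>.\<close>

lemma spine_law:
  assumes "i \<in> labels" and "\<And>k. F \<in> borel_measurable (Past k)"
  shows "(\<integral>\<^sup>+\<omega>. F \<omega> * of_bool (J (length i) \<omega> = i) \<partial>M) = (\<integral>\<^sup>+\<omega>. F \<omega> * path_prob \<alpha> N C i \<omega> \<partial>M)"
  using assms
proof (induction i arbitrary: F rule: rev_induct)
  case Nil
  show ?case by (intro nn_integral_cong) (simp add: J_0 path_prob_Nil)
next
  case (snoc j i)
  then have i: "i \<in> labels" "1 \<le> j" by auto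
  have "(\<integral>\<^sup>+\<omega>. F \<omega> * of_bool (J (length (i @ [j])) \<omega> = i @ [j]) \<partial>M) =
        (\<integral>\<^sup>+\<omega>. F \<omega> * of_bool (J (length i) \<omega> = i \<and> J (Suc (length i)) \<omega> = i @ [j]) \<partial>M)"
    by (rule nn_integral_cong_AE) (use AE_spine in eventually_elim, auto, metis butlast_snoc)
  also have "\<dots> = (\<integral>\<^sup>+\<omega>. F \<omega> * step_prob \<alpha> N C i j \<omega> * of_bool (J (length i) \<omega> = i) \<partial>M)"
    by (rule spine_step[OF i snoc.prems(2)])
  also have "\<dots> = (\<integral>\<^sup>+\<omega>. F \<omega> * step_prob \<alpha> N C i j \<omega> * path_prob \<alpha> N C i \<omega> \<partial>M)"
    using i snoc.prems(2) step_prob_Past by (intro snoc.IH borel_measurable_times) auto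
  finally show ?case by (simp add: path_prob_snoc mult.assoc)
qed


section \<open>The change of measure\<close>

lemma subalgebra_G: "subalgebra M (G k)"
proof -
  have "sets (F_alg M N Q C k) \<subseteq> sets M"
    unfolding sets_F_alg
  proof (rule sets.sigma_sets_subset, safe)
    fix i s B assume i: "i \<in> labels" and B: "B \<in> sets bvec_space"
    have [measurable]: "psi N Q C i \<in> M \<rightarrow>\<^sub>M bvec_space" "Measurable.pred M (\<lambda>\<omega>. i \<in> tree N \<omega>)"
      using i tree_measurable[where k="length i" and i=i, OF psi_M] psi_M by auto
    note [measurable] = B
    show "{\<omega> \<in> space M. i \<in> generation N s \<omega> \<and> psi N Q C i \<omega> \<in> B} \<in> sets M"
      unfolding generation_iff_tree by measurable
  qed
  then have "sets (G k) \<subseteq> sets M"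
    unfolding sets_G_alg using J_singleton_M by (intro sets.sigma_sets_subset) auto
  then show ?thesis by (simp add: subalgebra_def)
qed

text \<open>Off the null event that the spine leaves \<^const>\<open>labels\<close>, nothing is known about the measurability of
  \<open>D\<close> along the spine, so \<open>L\<close> itself need not be measurable. It is replaced by the following version,
  which can serve as a density.\<close>

definition L_version :: "nat \<Rightarrow> 'a \<Rightarrow> ennreal" where
  "L_version k \<omega> = (\<Prod>r<k. if J r \<omega> \<in> labels then D \<alpha> N C (J r \<omega>) \<omega> else 0)"

lemma L_version_measurable [measurable]: "L_version k \<in> borel_measurable M"
proof -
  have "(\<lambda>\<omega>. if J r \<omega> \<in> labels then D \<alpha> N C (J r \<omega>) \<omega> else 0) \<in> borel_measurable M" for r
  proof (rule measurable_compose_countable[where g="J r" and f="\<lambda>i \<omega>. if i \<in> labels then D \<alpha> N C i \<omega> else 0"])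
    show "(\<lambda>\<omega>. if i \<in> labels then D \<alpha> N C i \<omega> else 0) \<in> borel_measurable M" for i
      using Past_M[OF D_Past] by (cases "i \<in> labels") auto
  qed measurable
  then show ?thesis unfolding L_version_def by measurable
qed

lemma AE_L_version: "AE \<omega> in M. L \<alpha> N C J k \<omega> = L_version k \<omega>"
  using AE_spine
proof eventually_elim
  case (elim \<omega>)
  then have "J r \<omega> \<in> labels" for r
    using generation_labels[of "J r \<omega>" N r \<omega>] by blast
  then show ?case by (simp add: L_def L_version_def)
qed

context
  fixes Pt :: "'a measure"
  assumes tilted: "is_tilted_measure M \<alpha> N Q C J Pt"
begin

lemma subalgebra_tilted: "subalgebra Pt (G k)"
  using tilted by (auto simp: subalgebra_def is_tilted_measure_def)

lemma emeasure_tilted: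
  "A \<in> sets (G k) \<Longrightarrow> emeasure Pt A = (\<integral>\<^sup>+\<omega>. indicator A \<omega> * L \<alpha> N C J k \<omega> \<partial>M)"
  using tilted by (simp add: is_tilted_measure_def)

text \<open>The measure \<open>Pt\<close> is given on each \<open>G\<^sub>k\<close> separately, so the comparison with the density is made between
  the restrictions of the two measures to \<open>G\<^sub>k\<close>.\<close>

lemma nn_integral_tilted:
  assumes f: "f \<in> borel_measurable (G k)"
  shows "(\<integral>\<^sup>+\<omega>. f \<omega> \<partial>Pt) = (\<integral>\<^sup>+\<omega>. f \<omega> * L \<alpha> N C J k \<omega> \<partial>M)"
proof -
  let ?M' = "density M (L_version k)"
  have sub: "subalgebra ?M' (G k)"
    using subalgebra_G by (simp add: subalgebra_def)
  have "restr_to_subalg Pt (G k) = restr_to_subalg ?M' (G k)"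
  proof (rule measure_eqI)
    show "sets (restr_to_subalg Pt (G k)) = sets (restr_to_subalg ?M' (G k))"
      by (simp add: sets_restr_to_subalg subalgebra_tilted sub)
    fix A assume "A \<in> sets (restr_to_subalg Pt (G k))"
    then have A: "A \<in> sets (G k)"
      by (simp add: sets_restr_to_subalg subalgebra_tilted)
    then have AM: "A \<in> sets M"
      using subalgebra_G[of k] by (auto simp: subalgebra_def)
    have "emeasure Pt A = (\<integral>\<^sup>+\<omega>. L_version k \<omega> * indicator A \<omega> \<partial>M)"
      unfolding emeasure_tilted[OF A]
      by (rule nn_integral_cong_AE) (use AE_L_version[of k] in eventually_elim, simp add: mult.commute)
    also have "\<dots> = emeasure ?M' A"
      using AM by (simp add: emeasure_density)
    finally show "emeasure (restr_to_subalg Pt (G k)) A = emeasure (restr_to_subalg ?M' (G k)) A"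
      using A by (simp add: emeasure_restr_to_subalg subalgebra_tilted sub)
  qed
  then have "(\<integral>\<^sup>+\<omega>. f \<omega> \<partial>Pt) = (\<integral>\<^sup>+\<omega>. f \<omega> \<partial>?M')"
    using nn_integral_subalgebra2[OF subalgebra_tilted f] nn_integral_subalgebra2[OF sub f] by simp
  also have "\<dots> = (\<integral>\<^sup>+\<omega>. L_version k \<omega> * f \<omega> \<partial>M)"
    using measurable_from_subalg[OF subalgebra_G f] by (intro nn_integral_density) auto
  also have "\<dots> = (\<integral>\<^sup>+\<omega>. f \<omega> * L \<alpha> N C J k \<omega> \<partial>M)"
    by (rule nn_integral_cong_AE) (use AE_L_version[of k] in eventually_elim, simp add: mult.commute)
  finally show ?thesis .
qed

text \<open>The exceptional event is null for the original measure, but it passes to \<open>Pt\<close> only since it belongs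
  to some \<open>G\<^sub>k\<close>: on the whole \<open>\<sigma>\<close>-algebra, \<open>Pt\<close> need not be absolutely continuous.\<close>

lemma AE_tilted_spine: "AE \<omega> in Pt. \<forall>k. J k \<omega> \<in> generation N k \<omega>"
proof -
  have "AE \<omega> in Pt. J k \<omega> \<in> generation N k \<omega>" for k
  proof -
    let ?B = "{\<omega> \<in> space M. J k \<omega> \<notin> generation N k \<omega>}"
    have eq: "J k \<omega> \<notin> generation N k \<omega> \<longleftrightarrow>
        (\<forall>i\<in>{i \<in> labels. length i = k}. \<not> (J k \<omega> = i \<and> i \<in> tree N \<omega>))" for \<omega>
      by (auto simp: generation_iff_tree dest: tree_labels)
    have "Measurable.pred (G (Suc k)) (\<lambda>\<omega>. J k \<omega> \<notin> generation N k \<omega>)"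
      unfolding eq
    proof (rule pred_intros_countable_bounded(3))
      fix i assume "i \<in> {i \<in> labels. length i = k}"
      then have [measurable]: "Measurable.pred (G (Suc k)) (\<lambda>\<omega>. J k \<omega> = i)"
          "Measurable.pred (G (Suc k)) (\<lambda>\<omega>. i \<in> tree N \<omega>)"
        by (auto intro: J_G_alg tree_G_alg)
      show "Measurable.pred (G (Suc k)) (\<lambda>\<omega>. \<not> (J k \<omega> = i \<and> i \<in> tree N \<omega>))"
        by measurable
    qed
    then have B: "?B \<in> sets (G (Suc k))" by (simp add: pred_def)
    have "emeasure Pt ?B = (\<integral>\<^sup>+\<omega>. 0 \<partial>M)"
      unfolding emeasure_tilted[OF B]
      by (rule nn_integral_cong_AE) (use AE_spine in eventually_elim, auto)
    then have "?B \<in> null_sets Pt"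
      using B subalgebra_tilted[of "Suc k"] by (auto simp: subalgebra_def)
    from AE_not_in[OF this] AE_space show ?thesis
      by eventually_elim (use tilted in \<open>auto simp: is_tilted_measure_def\<close>)
  qed
  then show ?thesis by (simp add: AE_all_countable)
qed

text \<open>Changing back to the original measure multiplies the payoff by \<open>D\<^sub>i\<close> and by the product of \<open>D\<close> over
  the strict ancestors of \<open>i\<close>; the former cancels against the payoff, the latter against the
  conditional probability of the path.\<close>

lemma tilted_payoff_at:
  assumes i: "i \<in> labels"
  shows "(\<integral>\<^sup>+\<omega>. of_bool (J (length i) \<omega> = i) * payoff_at \<alpha> N Q C t i \<omega> \<partial>Pt) =
         ennreal (exp (\<alpha> * t)) * emeasure M {\<omega> \<in> space M. gamma N Q C t \<omega> = Some i}"
    (is "?l = _")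
proof -
  let ?k = "length i"
  let ?e = "\<lambda>\<omega>. of_bool (gamma N Q C t \<omega> = Some i) *
      ennreal (exp (- \<alpha> * (real_of_ereal (S C i \<omega>) - t)))"
  let ?F = "\<lambda>\<omega>. ?e \<omega> * path_D \<alpha> N C i \<omega>"
  have D: "AE \<omega> in M. \<forall>i\<in>labels. D \<alpha> N C i \<omega> \<noteq> 0 \<and> D \<alpha> N C i \<omega> \<noteq> \<infinity>"
    using D_AE by (simp add: AE_ball_countable)
  have C: "AE \<omega> in M. \<forall>i\<in>labels. \<forall>j\<ge>1. 0 \<le> C (i @ [j]) \<omega>"
    using C_AE by (simp add: AE_ball_countable)
  have [measurable]: "Measurable.pred (G (Suc ?k)) (\<lambda>\<omega>. J ?k \<omega> = i)"
      "payoff_at \<alpha> N Q C t i \<in> borel_measurable (G (Suc ?k))"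
    using i by (auto intro: J_G_alg payoff_at_G_alg)
  have F: "?F \<in> borel_measurable (Past k)" for k
  proof -
    have take: "take r i \<in> labels" for r
      using i by (auto simp: labels_def dest: in_set_takeD)
    have [measurable]: "Measurable.pred (Past k) (\<lambda>\<omega>. gamma N Q C t \<omega> = Some i)"
        "S C i \<in> borel_measurable (Past k)"
      using i gamma_measurable[where k="?k" and i=i, OF psi_spine_past]
        S_measurable[where k="?k" and i=i, OF psi_spine_past] by auto
    have [measurable]: "path_D \<alpha> N C i \<in> borel_measurable (Past k)"
      unfolding path_D_def using D_Past[OF take] by measurable
    show ?thesis unfolding of_bool_def by measurable
  qed
  \<comment> \<open>The time \<open>|i| + 1\<close> is the first at which \<open>\<psi>\<^sub>i\<close>, and thus \<open>\<gamma>(t) = i\<close>, is known.\<close>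
  have "?l = (\<integral>\<^sup>+\<omega>. (of_bool (J ?k \<omega> = i) * payoff_at \<alpha> N Q C t i \<omega>) * L \<alpha> N C J (Suc ?k) \<omega> \<partial>M)"
    by (rule nn_integral_tilted) (simp add: of_bool_def)
  also have "\<dots> = (\<integral>\<^sup>+\<omega>. ?F \<omega> * of_bool (J ?k \<omega> = i) \<partial>M)"
  proof (rule nn_integral_cong_AE, use AE_prefix D in eventually_elim)
    case (elim \<omega>)
    show ?case
    proof (cases "J ?k \<omega> = i")
      case True
      have "J r \<omega> = take r i" if "r \<le> ?k" for r
        using elim(1)[rule_format, OF that] unfolding True .
      then have "L \<alpha> N C J (Suc ?k) \<omega> = D \<alpha> N C i \<omega> * path_D \<alpha> N C i \<omega>"
        by (simp add: L_def path_D_def mult.commute)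
      then have "payoff_at \<alpha> N Q C t i \<omega> * L \<alpha> N C J (Suc ?k) \<omega> =
          ?F \<omega> * (D \<alpha> N C i \<omega> * inverse (D \<alpha> N C i \<omega>))"
        by (simp only: payoff_at_def mult_ac)
      also have "D \<alpha> N C i \<omega> * inverse (D \<alpha> N C i \<omega>) = 1"
        using elim(2) i ennreal_divide_self[of "D \<alpha> N C i \<omega>"]
        by (simp add: divide_ennreal_def less_top)
      finally show ?thesis using True by simp
    qed simp
  qed
  also have "\<dots> = (\<integral>\<^sup>+\<omega>. ?F \<omega> * path_prob \<alpha> N C i \<omega> \<partial>M)"
    by (rule spine_law[OF i F])
  also have "\<dots> = (\<integral>\<^sup>+\<omega>. ennreal (exp (\<alpha> * t)) *
      indicator {\<omega> \<in> space M. gamma N Q C t \<omega> = Some i} \<omega> \<partial>M)"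
  proof (rule nn_integral_cong_AE, use C D AE_space in eventually_elim)
    case (elim \<omega>)
    show ?case
    proof (cases "gamma N Q C t \<omega> = Some i")
      case True
      then have exc: "i \<in> exceedances N Q C t \<omega>"
        by (simp add: gamma_eq_Some_iff)
      have w: "path_D \<alpha> N C i \<omega> * path_prob \<alpha> N C i \<omega> = ennreal (weight C i \<omega> powr \<alpha>)"
        "0 \<le> weight C i \<omega>"
        using path_D_times_path_prob[of i N \<omega> \<alpha> C] exc elim by (auto simp: exceedances_def)
      with exceedance_weight_nonzero[OF exc] have pos: "0 < weight C i \<omega>" by simp
      have "exp (- \<alpha> * (real_of_ereal (S C i \<omega>) - t)) * weight C i \<omega> powr \<alpha> = exp (\<alpha> * t)"
        using pos by (simp add: S_def elog_def powr_def exp_add[symmetric] algebra_simps)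
      then have "?F \<omega> * path_prob \<alpha> N C i \<omega> = ennreal (exp (\<alpha> * t))"
        using True w(1) by (simp add: mult.assoc ennreal_mult[symmetric])
      then show ?thesis using True elim by simp
    qed simp
  qed
  also have "\<dots> = ennreal (exp (\<alpha> * t)) * emeasure M {\<omega> \<in> space M. gamma N Q C t \<omega> = Some i}"
    using gamma_M[OF i] by (intro nn_integral_cmult_indicator) (simp add: pred_def)
  finally show ?thesis .
qed

lemma tail_identity:
  "ennreal (exp (\<alpha> * t) * measure M {\<omega> \<in> space M. W N Q C \<omega> > ereal t}) =
   (\<integral>\<^sup>+\<omega>. hitting_payoff \<alpha> N Q C J t \<omega> \<partial>Pt)"
proof -
  let ?\<Gamma> = "\<lambda>i. {\<omega> \<in> space M. gamma N Q C t \<omega> = Some i}"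
  have \<Gamma>: "?\<Gamma> i \<in> sets M" if "i \<in> labels" for i
    using gamma_M[OF that] by (simp add: pred_def)
  have meas: "(\<lambda>\<omega>. of_bool (J (length i) \<omega> = i) * payoff_at \<alpha> N Q C t i \<omega>) \<in> borel_measurable Pt"
    if "i \<in> labels" for i
  proof (rule measurable_from_subalg[OF subalgebra_tilted])
    have [measurable]: "Measurable.pred (G (Suc (length i))) (\<lambda>\<omega>. J (length i) \<omega> = i)"
      "payoff_at \<alpha> N Q C t i \<in> borel_measurable (G (Suc (length i)))"
      using that by (auto intro: J_G_alg payoff_at_G_alg)
    show "(\<lambda>\<omega>. of_bool (J (length i) \<omega> = i) * payoff_at \<alpha> N Q C t i \<omega>)
        \<in> borel_measurable (G (Suc (length i)))"
      unfolding of_bool_def by measurable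
  qed
  have "(\<integral>\<^sup>+\<omega>. hitting_payoff \<alpha> N Q C J t \<omega> \<partial>Pt) =
      (\<integral>\<^sup>+\<omega>. \<integral>\<^sup>+i. of_bool (J (length i) \<omega> = i) * payoff_at \<alpha> N Q C t i \<omega> \<partial>count_space labels \<partial>Pt)"
    by (rule nn_integral_cong_AE) (use AE_tilted_spine in eventually_elim, rule hitting_payoff_eq, blast)
  also have "\<dots> = (\<integral>\<^sup>+i. \<integral>\<^sup>+\<omega>. of_bool (J (length i) \<omega> = i) * payoff_at \<alpha> N Q C t i \<omega> \<partial>Pt
      \<partial>count_space labels)"
    by (rule nn_integral_count_space_nn_integral[OF _ meas]) auto
  also have "\<dots> = (\<integral>\<^sup>+i. ennreal (exp (\<alpha> * t)) * emeasure M (?\<Gamma> i) \<partial>count_space labels)"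
    by (intro nn_integral_cong tilted_payoff_at) simp
  also have "\<dots> = ennreal (exp (\<alpha> * t)) * (\<integral>\<^sup>+i. emeasure M (?\<Gamma> i) \<partial>count_space labels)"
    by (rule nn_integral_cmult) simp
  also have "(\<integral>\<^sup>+i. emeasure M (?\<Gamma> i) \<partial>count_space labels) = emeasure M (\<Union>i\<in>labels. ?\<Gamma> i)"
    by (rule emeasure_UN_countable[symmetric]) (use \<Gamma> in \<open>auto simp: disjoint_family_on_def\<close>)
  also have "(\<Union>i\<in>labels. ?\<Gamma> i) = {\<omega> \<in> space M. W N Q C \<omega> > ereal t}"
    by (auto simp: W_greater_iff)
  finally show ?thesis
    by (simp add: emeasure_eq_measure ennreal_mult)
qed

end

end

section \<open>I.i.d. branching vectors\<close>

theorem mainTheorem2: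
  fixes M0 :: "'b measure"
    and N0 :: "'b \<Rightarrow> enat" and Q0 :: "'b \<Rightarrow> real" and C0 :: "nat \<Rightarrow> 'b \<Rightarrow> real"
    and M :: "'a measure"
    and N :: "nat list \<Rightarrow> 'a \<Rightarrow> enat"
    and Q :: "nat list \<Rightarrow> 'a \<Rightarrow> real"
    and C :: "nat list \<Rightarrow> 'a \<Rightarrow> real"
    and J :: "nat \<Rightarrow> 'a \<Rightarrow> nat list"
    and Pt :: "'a measure"
    and \<alpha> :: real
  assumes M0: "prob_space M0"
    and vector: "(\<lambda>x. bvec (N0 x) (Q0 x) (\<lambda>j. C0 j x)) \<in> M0 \<rightarrow>\<^sub>M bvec_space"
    and nonneg: "AE x in M0. 1 \<le> N0 x \<and> 0 \<le> Q0 x \<and> (\<forall>j\<ge>1. 0 \<le> C0 j x)"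
    and Q_pos: "measure M0 {x \<in> space M0. 0 < Q0 x} > 0"
    and alpha: "0 < \<alpha>"
    and a1: "(\<integral>\<^sup>+x. branch_sum (N0 x) (\<lambda>j. ennreal (C0 j x powr \<alpha>)) \<partial>M0) = 1"
    and a2_summable: "AE x in M0. summable (branch_term (N0 x) (\<lambda>j. C0 j x powr \<alpha> * ln (C0 j x)))"
    and a2_integrable:
      "integrable M0 (\<lambda>x. branch_sum (N0 x) (\<lambda>j. C0 j x powr \<alpha> * ln (C0 j x)))"
    and a2_pos: "(\<integral>x. branch_sum (N0 x) (\<lambda>j. C0 j x powr \<alpha> * ln (C0 j x)) \<partial>M0) > 0"
    and b1: "\<exists>\<beta>. 0 < \<beta> \<and> \<beta> < \<alpha> \<and>
      (\<integral>\<^sup>+x. branch_sum (N0 x) (\<lambda>j. ennreal (C0 j x powr \<beta>)) \<partial>M0) < 1"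
    and b2: "(\<integral>\<^sup>+x. ennreal (Q0 x powr \<alpha>) \<partial>M0) < \<infinity>"
    and c: "measure M0 {x \<in> space M0. branch_sum (N0 x) (\<lambda>j. ennreal (C0 j x powr \<alpha>)) = 0} = 0"
    and M: "prob_space M"
    and indep: "prob_space.indep_vars M (\<lambda>_. bvec_space) (psi N Q C) labels"
    and copies: "\<And>i. i \<in> labels \<Longrightarrow>
      distr M bvec_space (psi N Q C i) =
      distr M0 bvec_space (\<lambda>x. bvec (N0 x) (Q0 x) (\<lambda>j. C0 j x))"
    and spine: "is_spine M \<alpha> N Q C J"
    and tilted: "is_tilted_measure M \<alpha> N Q C J Pt"
  shows "\<forall>t::real.
    ennreal (exp (\<alpha> * t) * measure M {\<omega> \<in> space M. W N Q C \<omega> > ereal t}) =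
    (\<integral>\<^sup>+\<omega>. hitting_payoff \<alpha> N Q C J t \<omega> \<partial>Pt)"
proof -
  interpret M0: prob_space M0 by (rule M0)
  interpret M: prob_space M by (rule M)
  let ?v = "\<lambda>x. bvec (N0 x) (Q0 x) (\<lambda>j. C0 j x)"
  have psi_M: "psi N Q C i \<in> M \<rightarrow>\<^sub>M bvec_space" if "i \<in> labels" for i
    using indep that by (auto simp: M.indep_vars_def)
  have transfer: "AE \<omega> in M. P (psi N Q C i \<omega>)"
    if i: "i \<in> labels" and P: "{v \<in> space bvec_space. P v} \<in> sets bvec_space"
      and AE0: "AE x in M0. P (?v x)" for i P
  proof -
    have "AE v in distr M0 bvec_space ?v. P v"
      using AE0 by (subst AE_distr_iff[OF vector P])
    then show ?thesis
      unfolding copies[OF i, symmetric] by (subst (asm) AE_distr_iff[OF psi_M[OF i] P])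
  qed
  have [measurable]: "?v \<in> M0 \<rightarrow>\<^sub>M bvec_space" by (rule vector)
  let ?D0 = "\<lambda>x. branch_sum (N0 x) (\<lambda>j. ennreal (C0 j x powr \<alpha>))"
  have D0 [measurable]: "?D0 \<in> borel_measurable M0"
    using measurable_compose[OF vector branch_alpha_measurable[of \<alpha>]]
    by (simp add: bvec_branch_alpha)
  have D0_finite: "AE x in M0. ?D0 x \<noteq> \<infinity>"
    using a1 by (intro nn_integral_PInf_AE) auto
  have D0_pos: "AE x in M0. ?D0 x \<noteq> 0"
  proof -
    have "{x \<in> space M0. ?D0 x = 0} \<in> null_sets M0"
      using c by (auto simp: null_sets_def M0.emeasure_eq_measure)
    from AE_not_in[OF this] AE_space show ?thesis by eventually_elim auto
  qed
  \<comment> \<open>As \<open>D\<close> has mean one, it is almost surely finite; that it does not vanish is assumption \<open>c\<close>.\<close>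
  interpret spine_tree M N Q C J \<alpha>
  proof unfold_locales
    fix i assume i: "i \<in> labels"
    show "psi N Q C i \<in> M \<rightarrow>\<^sub>M bvec_space" by (rule psi_M[OF i])
    have "AE \<omega> in M. branch_alpha \<alpha> (psi N Q C i \<omega>) \<noteq> 0 \<and> branch_alpha \<alpha> (psi N Q C i \<omega>) \<noteq> \<infinity>"
    proof (rule transfer[OF i])
      show "AE x in M0. branch_alpha \<alpha> (?v x) \<noteq> 0 \<and> branch_alpha \<alpha> (?v x) \<noteq> \<infinity>"
        using D0_finite D0_pos by (simp add: bvec_branch_alpha)
    qed measurable
    then show "AE \<omega> in M. D \<alpha> N C i \<omega> \<noteq> 0 \<and> D \<alpha> N C i \<omega> \<noteq> \<infinity>"
      by (simp add: D_eq[symmetric])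
    have "AE \<omega> in M. \<forall>j\<ge>1. 0 \<le> snd (snd (psi N Q C i \<omega>)) j"
    proof (rule transfer[OF i nonneg_coord_sets])
      show "AE x in M0. \<forall>j\<ge>1. 0 \<le> snd (snd (?v x)) j"
        using nonneg by eventually_elim (simp add: bvec_def)
    qed
    then show "AE \<omega> in M. \<forall>j\<ge>1. 0 \<le> C (i @ [j]) \<omega>"
      by (simp add: psi_def bvec_def)
  qed (rule spine)
  show ?thesis
    using tail_identity[OF tilted] by blast
qed

end
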